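(* Let $A$ be a 4-dimensional complex 3-Lie algebra with basis $\{e_1,e_2,e_3,e_4\}$ whose non-zero brackets of basis elements (up to skew-symmetry) are given by one of the following lists: Case (1): $[e_1,e_2,e_3]=e_4,\ [e_1,e_2,e_4]=e_3,\ [e_1,e_3,e_4]=e_2,\ [e_2,e_3,e_4]=e_1$; Case (3): $[e_2,e_3,e_4]=e_1$; Case (4): $[e_2,e_3,e_4]=e_1,\ [e_1,e_3,e_4]=e_2$; Case (7): $[e_1,e_2,e_4]=e_3,\ [e_1,e_3,e_4]=e_2,\ [e_2,e_3,e_4]=e_1$. Then any skew-symmetric $r\in\wedge^2(A)$ satisfies $[[r,r,r]]=0$.
   Context: A 3-Lie algebra is a vector space $A$ with a trilinear, totally skew-symmetric bracket $[\cdot,\cdot,\cdot]:\otimes^3A\to A$ such that for all $x_1,\dots,x_5\in A$: $[x_1,x_2,[x_3,x_4,x_5]]=[[x_1,x_2,x_3],x_4,x_5]+[x_3,[x_1,x_2,x_4],x_5]+[x_3,x_4,[x_1,x_2,x_5]]$. For $r=\sum_i x_i\otimes y_i\in A\otimes A$, the element $[[r,r,r]]\in\otimes^4A$ is $$[[r,r,r]]=\sum_{i,j,k}\big([x_i,x_j,x_k]\otimes y_i\otimes y_j\otimes y_k+x_i\otimes[y_i,x_j,x_k]\otimes y_j\otimes y_k+x_i\otimes x_j\otimes[y_i,y_j,x_k]\otimes y_k+x_i\otimes x_j\otimes x_k\otimes[y_i,y_j,y_k]\big).$$ Here $\wedge^2(A)\subseteq A\otimes A$ is the span of the elements $x\wedge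 y=x\otimes y-y\otimes x$, i.e. the skew-symmetric tensors. The equation $[[r,r,r]]=0$ is called the 3-Lie classical Yang-Baxter equation. *)

theory Defs
  imports Complex_Main "HOL-Library.Poly_Mapping"
begin

section \<open>Complex vector spaces\<close>

class complex_vector = ab_group_add +
  fixes scaleC :: "complex \<Rightarrow> 'a \<Rightarrow> 'a"  (infixr "*\<^sub>C" 75)
  assumes scaleC_add_right: "c *\<^sub>C (x + y) = c *\<^sub>C x + c *\<^sub>C y"
    and scaleC_add_left: "(c + d) *\<^sub>C x = c *\<^sub>C x + d *\<^sub>C x"
    and scaleC_scaleC: "c *\<^sub>C d *\<^sub>C x = (c * d) *\<^sub>C x"
    and scaleC_one: "1 *\<^sub>C x = x"

global_interpretation complex_vector:
  vector_space "scaleC :: complex \<Rightarrow> 'a \<Rightarrow> 'a::complex_vector"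
  by unfold_locales
    (simp_all add: scaleC_add_right scaleC_add_left scaleC_scaleC scaleC_one)

abbreviation clinear :: "('a::complex_vector \<Rightarrow> 'b::complex_vector) \<Rightarrow> bool"
  where "clinear \<equiv> Vector_Spaces.linear scaleC scaleC"

lemma clinearI:
  assumes "\<And>x y. f (x + y) = f x + f y" "\<And>c x. f (c *\<^sub>C x) = c *\<^sub>C f x"
  shows "clinear f"
  using assms
  by (simp add: Vector_Spaces.linear_iff complex_vector.vector_space_axioms)

lemma clinearD:
  assumes "clinear f"
  shows "f (x + y) = f x + f y" "f (c *\<^sub>C x) = c *\<^sub>C f x"
  using assms by (simp_all add: Vector_Spaces.linear_iff)

section \<open>The tensor product of two vector spaces\<close>

text \<open>
  The usual construction: the free vector space on \<open>'a \<times> 'b\<close>, whose elements are the finitely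
  supported functions, divided by the span of the bilinearity relators.
\<close>

definition free_scale :: "complex \<Rightarrow> ('x \<Rightarrow>\<^sub>0 complex) \<Rightarrow> ('x \<Rightarrow>\<^sub>0 complex)"
  where "free_scale c = Poly_Mapping.map ((*) c)"

lemma lookup_free_scale [simp]:
  "Poly_Mapping.lookup (free_scale c f) x = c * Poly_Mapping.lookup f x"
  by (simp add: free_scale_def map.rep_eq when_def)

global_interpretation free: vector_space "free_scale :: complex \<Rightarrow> ('x \<Rightarrow>\<^sub>0 complex) \<Rightarrow> _"
  by unfold_locales
    (auto intro!: poly_mapping_eqI simp: lookup_add algebra_simps)

abbreviation gen :: "'a \<Rightarrow> 'b \<Rightarrow> ('a \<times> 'b) \<Rightarrow>\<^sub>0 complex"
  where "gen x y \<equiv> Poly_Mapping.single (x, y) 1"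

definition tensor_relators :: "(('a::complex_vector \<times> 'b::complex_vector) \<Rightarrow>\<^sub>0 complex) set"
  where "tensor_relators =
    {gen (x + x') y - gen x y - gen x' y | x x' y. True} \<union>
    {gen x (y + y') - gen x y - gen x y' | x y y'. True} \<union>
    {gen (c *\<^sub>C x) y - free_scale c (gen x y) | c x y. True} \<union>
    {gen x (c *\<^sub>C y) - free_scale c (gen x y) | c x y. True}"

definition tensor_eq ::
  "(('a::complex_vector \<times> 'b::complex_vector) \<Rightarrow>\<^sub>0 complex) \<Rightarrow> _ \<Rightarrow> bool"
  where "tensor_eq f g \<longleftrightarrow> f - g \<in> free.span tensor_relators"

lemma tensor_eq_equivp: "equivp tensor_eq"
proof (rule equivpI)
  show "reflp tensor_eq"
    by (auto simp: reflp_def tensor_eq_def free.span_zero)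
  show "symp tensor_eq"
    unfolding symp_def tensor_eq_def by (metis free.span_neg minus_diff_eq)
  show "transp tensor_eq"
    unfolding transp_def tensor_eq_def
    using free.span_add [of "f - g" tensor_relators "g - h" for f g h] by fastforce
qed

quotient_type (overloaded) ('a, 'b) tensor =
  "('a::complex_vector \<times> 'b::complex_vector) \<Rightarrow>\<^sub>0 complex" / tensor_eq
  by (rule tensor_eq_equivp)

instantiation tensor :: (complex_vector, complex_vector) complex_vector
begin

lift_definition zero_tensor :: "('a, 'b) tensor" is 0 .

lift_definition plus_tensor :: "('a, 'b) tensor \<Rightarrow> ('a, 'b) tensor \<Rightarrow> ('a, 'b) tensor" is "(+)"
  unfolding tensor_eq_def by (metis free.span_add add_diff_add)

lift_definition uminus_tensor :: "('a, 'b) tensor \<Rightarrow> ('a, 'b) tensor" is uminus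
  unfolding tensor_eq_def by (metis free.span_neg minus_diff_minus)

lift_definition minus_tensor :: "('a, 'b) tensor \<Rightarrow> ('a, 'b) tensor \<Rightarrow> ('a, 'b) tensor" is "(-)"
proof -
  fix f f' g g' :: "('a \<times> 'b) \<Rightarrow>\<^sub>0 complex"
  assume "tensor_eq f f'" "tensor_eq g g'"
  then have "(f - f') - (g - g') \<in> free.span tensor_relators"
    unfolding tensor_eq_def by (rule free.span_diff)
  then show "tensor_eq (f - g) (f' - g')"
    by (simp add: tensor_eq_def algebra_simps)
qed

lift_definition scaleC_tensor :: "complex \<Rightarrow> ('a, 'b) tensor \<Rightarrow> ('a, 'b) tensor" is free_scale
  unfolding tensor_eq_def by (metis free.span_scale free.scale_right_diff_distrib)

instance
proof
  note refl = equivp_reflp [OF tensor_eq_equivp]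
  fix a b c :: "('a, 'b) tensor" and k l :: complex
  show "a + b + c = a + (b + c)" by transfer (simp add: add.assoc refl)
  show "a + b = b + a" by transfer (simp add: add.commute refl)
  show "0 + a = a" by transfer (simp add: refl)
  show "- a + a = 0" by transfer (simp add: refl)
  show "a - b = a + - b" by transfer (simp add: refl)
  show "k *\<^sub>C (a + b) = k *\<^sub>C a + k *\<^sub>C b"
    by transfer (simp add: free.scale_right_distrib refl)
  show "(k + l) *\<^sub>C a = k *\<^sub>C a + l *\<^sub>C a"
    by transfer (simp add: free.scale_left_distrib refl)
  show "k *\<^sub>C l *\<^sub>C a = (k * l) *\<^sub>C a" by transfer (simp add: refl)
  show "1 *\<^sub>C a = a" by transfer (simp add: refl)
qed

end

lift_definition pure_tensor :: "'a::complex_vector \<Rightarrow> 'b::complex_vector \<Rightarrow> ('a, 'b) tensor"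
  (infixl "\<otimes>" 70) is gen .

lemma tensor_relators_intros:
  "gen (x + x') y - gen x y - gen x' y \<in> tensor_relators"
  "gen x (y + y') - gen x y - gen x y' \<in> tensor_relators"
  "gen (c *\<^sub>C x) y - free_scale c (gen x y) \<in> tensor_relators"
  "gen x (c *\<^sub>C y) - free_scale c (gen x y) \<in> tensor_relators"
  unfolding tensor_relators_def by blast+

lemma tensor_add_left: "(x + x') \<otimes> y = x \<otimes> y + x' \<otimes> y"
  by transfer
    (metis tensor_eq_def diff_diff_eq free.span_base tensor_relators_intros(1))

lemma tensor_add_right: "x \<otimes> (y + y') = x \<otimes> y + x \<otimes> y'"
  by transfer
    (metis tensor_eq_def diff_diff_eq free.span_base tensor_relators_intros(2))

lemma tensor_scale_left: "(c *\<^sub>C x) \<otimes> y = c *\<^sub>C (x \<otimes> y)"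
  by transfer (simp add: tensor_eq_def free.span_base tensor_relators_intros)

lemma tensor_scale_right: "x \<otimes> (c *\<^sub>C y) = c *\<^sub>C (x \<otimes> y)"
  by transfer (simp add: tensor_eq_def free.span_base tensor_relators_intros)

definition cbilinear ::
  "('a::complex_vector \<Rightarrow> 'b::complex_vector \<Rightarrow> 'c::complex_vector) \<Rightarrow> bool"
  where "cbilinear B \<longleftrightarrow> (\<forall>y. clinear (\<lambda>x. B x y)) \<and> (\<forall>x. clinear (\<lambda>y. B x y))"

definition pure_sum :: "('a::complex_vector \<times> 'b::complex_vector) list \<Rightarrow> ('a, 'b) tensor"
  where "pure_sum ps = (\<Sum>(x, y)\<leftarrow>ps. x \<otimes> y)"

definition free_lift ::
  "('a \<Rightarrow> 'b \<Rightarrow> 'c::complex_vector) \<Rightarrow> (('a \<times> 'b) \<Rightarrow>\<^sub>0 complex) \<Rightarrow> 'c"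
  where "free_lift B f = (\<Sum>p\<in>Poly_Mapping.keys f. Poly_Mapping.lookup f p *\<^sub>C case_prod B p)"

lemma free_lift_superset:
  assumes "finite S" "Poly_Mapping.keys f \<subseteq> S"
  shows "free_lift B f = (\<Sum>p\<in>S. Poly_Mapping.lookup f p *\<^sub>C case_prod B p)"
  unfolding free_lift_def using assms
  by (intro sum.mono_neutral_left) (auto simp: in_keys_iff)

lemma free_lift_gen: "free_lift B (gen x y) = B x y"
  by (simp add: free_lift_def scaleC_one)

lemma free_lift_add: "free_lift B (f + g) = free_lift B f + free_lift B g"
proof -
  let ?S = "Poly_Mapping.keys f \<union> Poly_Mapping.keys g"
  have "Poly_Mapping.keys (f + g) \<subseteq> ?S" by (rule keys_add)
  then show ?thesis
    by (simp add: free_lift_superset [of ?S] lookup_add scaleC_add_left sum.distrib)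
qed

lemma free_lift_scale: "free_lift B (free_scale c f) = c *\<^sub>C free_lift B f"
proof -
  have "Poly_Mapping.keys (free_scale c f) \<subseteq> Poly_Mapping.keys f"
    by (auto simp: in_keys_iff)
  then show ?thesis
    by (simp add: free_lift_superset [of "Poly_Mapping.keys f"] complex_vector.scale_sum_right
        scaleC_scaleC)
qed

lemma free_lift_diff: "free_lift B (f - g) = free_lift B f - free_lift B g"
  using free_lift_add [of B "f - g" g] by (simp add: algebra_simps)

lemma free_lift_relators:
  assumes B: "cbilinear B" and f: "f \<in> free.span tensor_relators"
  shows "free_lift B f = 0"
  using f
proof (induction rule: free.span_induct_alt)
  case base
  show ?case by (simp add: free_lift_def)
next
  case (step c x y)
  have "free_lift B x = 0"
    using step(1) B unfolding tensor_relators_def cbilinear_def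
    by (auto simp: free_lift_diff free_lift_scale free_lift_gen clinearD
        clinearD [of "\<lambda>x. B x _"])
  then show ?case using step by (simp add: free_lift_add free_lift_scale)
qed

lift_definition tensor_lift ::
  "('a::complex_vector \<Rightarrow> 'b::complex_vector \<Rightarrow> 'c::complex_vector) \<Rightarrow> ('a, 'b) tensor \<Rightarrow> 'c"
  is "\<lambda>B f. if cbilinear B then free_lift B f else 0"
  by (metis free_lift_diff free_lift_relators right_minus_eq tensor_eq_def)

lemma tensor_lift_pure: "cbilinear B \<Longrightarrow> tensor_lift B (x \<otimes> y) = B x y"
  by transfer (simp add: free_lift_gen)

lemma tensor_lift_add: "cbilinear B \<Longrightarrow> tensor_lift B (s + t) = tensor_lift B s + tensor_lift B t"
  by transfer (simp add: free_lift_add)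

lemma tensor_lift_pure_sum:
  assumes "cbilinear B"
  shows "tensor_lift B (pure_sum ps) = (\<Sum>(x, y)\<leftarrow>ps. B x y)"
proof (induction ps)
  case Nil
  show ?case using tensor_lift_add [OF assms, of 0 0] by (simp add: pure_sum_def)
next
  case (Cons p ps)
  then show ?case
    by (cases p) (simp add: pure_sum_def tensor_lift_add tensor_lift_pure assms)
qed

lemma ex_pure_sum: "\<exists>ps. t = pure_sum ps"
proof -
  have "\<exists>ps. abs_tensor f = pure_sum ps"
    if "finite S" "Poly_Mapping.keys f \<subseteq> S" for S and f :: "('a \<times> 'b) \<Rightarrow>\<^sub>0 complex"
    using that
  proof (induction S arbitrary: f)
    case empty
    then have "abs_tensor f = pure_sum []"
      by (simp add: pure_sum_def zero_tensor_def)
    then show ?case by blast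
  next
    case (insert p S)
    obtain x y where p: "p = (x, y)" by force
    define c where "c = Poly_Mapping.lookup f p"
    define g where "g = f - free_scale c (gen x y)"
    have "Poly_Mapping.keys g \<subseteq> S"
      using insert.prems
      by (auto simp: g_def c_def p in_keys_iff lookup_minus lookup_single when_def
          split: if_splits)
    then obtain ps where ps: "abs_tensor g = pure_sum ps" using insert.IH by blast
    have "abs_tensor f = abs_tensor (free_scale c (gen x y)) + abs_tensor g"
      by (simp add: g_def plus_tensor.abs_eq)
    also have "abs_tensor (free_scale c (gen x y)) = (c *\<^sub>C x) \<otimes> y"
      by (metis tensor_scale_left scaleC_tensor.abs_eq pure_tensor.abs_eq)
    finally have "abs_tensor f = pure_sum ((c *\<^sub>C x, y) # ps)"
      by (simp add: ps pure_sum_def)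
    then show ?case by blast
  qed
  from this [OF finite_keys subset_refl] show ?thesis
    by (induction t rule: tensor.abs_induct) blast
qed

type_synonym 'a tensor4 = "((('a, 'a) tensor, 'a) tensor, 'a) tensor"

definition wedge :: "'a::complex_vector \<Rightarrow> 'a \<Rightarrow> ('a, 'a) tensor"
  where "wedge x y = x \<otimes> y - y \<otimes> x"

definition wedge2 :: "('a::complex_vector, 'a) tensor set"
  where "wedge2 = complex_vector.span {wedge x y | x y. True}"

section \<open>3-Lie algebras and the 3-Lie classical Yang-Baxter equation\<close>

text \<open>Total skew-symmetry is stated for the two adjacent transpositions, which generate.\<close>

locale three_lie_algebra =
  fixes br :: "'a::complex_vector \<Rightarrow> 'a \<Rightarrow> 'a \<Rightarrow> 'a"
  assumes linear_1: "clinear (\<lambda>x. br x y z)"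
    and linear_2: "clinear (\<lambda>y. br x y z)"
    and linear_3: "clinear (\<lambda>z. br x y z)"
    and skew_12: "br y x z = - br x y z"
    and skew_23: "br x z y = - br x y z"
    and fundamental_identity:
      "br x1 x2 (br x3 x4 x5) =
        br (br x1 x2 x3) x4 x5 + br x3 (br x1 x2 x4) x5 + br x3 x4 (br x1 x2 x5)"

definition yb_term ::
  "('a::complex_vector \<Rightarrow> 'a \<Rightarrow> 'a \<Rightarrow> 'a) \<Rightarrow> 'a \<times> 'a \<Rightarrow> 'a \<times> 'a \<Rightarrow> 'a \<times> 'a \<Rightarrow> 'a tensor4"
  where "yb_term br = (\<lambda>(xi, yi) (xj, yj) (xk, yk).
    br xi xj xk \<otimes> yi \<otimes> yj \<otimes> yk +
    xi \<otimes> br yi xj xk \<otimes> yj \<otimes> yk +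
    xi \<otimes> xj \<otimes> br yi yj xk \<otimes> yk +
    xi \<otimes> xj \<otimes> xk \<otimes> br yi yj yk)"

definition yb_sum ::
  "('a::complex_vector \<Rightarrow> 'a \<Rightarrow> 'a \<Rightarrow> 'a) \<Rightarrow> ('a \<times> 'a) list \<Rightarrow> 'a tensor4"
  where "yb_sum br ps = (\<Sum>p\<leftarrow>ps. \<Sum>q\<leftarrow>ps. \<Sum>s\<leftarrow>ps. yb_term br p q s)"

text \<open>
  The element \<open>[[r,r,r]]\<close>. By lemma \<open>yang_baxter_eq\<close> below, the choice of the representation
  of \<open>r\<close> as a sum of pure tensors is immaterial.
\<close>

definition yang_baxter ::
  "('a::complex_vector \<Rightarrow> 'a \<Rightarrow> 'a \<Rightarrow> 'a) \<Rightarrow> ('a, 'a) tensor \<Rightarrow> 'a tensor4"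
  where "yang_baxter br r = yb_sum br (SOME ps. r = pure_sum ps)"

context three_lie_algebra
begin

lemmas multilinear_simps =
  clinearD [OF linear_1] clinearD [OF linear_2] clinearD [OF linear_3]
  tensor_add_left tensor_add_right tensor_scale_left tensor_scale_right

lemma yb_term_bilinear:
  "cbilinear (\<lambda>x y. yb_term br (x, y) q s)"
  "cbilinear (\<lambda>x y. yb_term br p (x, y) s)"
  "cbilinear (\<lambda>x y. yb_term br p q (x, y))"
  unfolding cbilinear_def yb_term_def
  by (auto split: prod.splits intro!: clinearI simp: multilinear_simps scaleC_add_right)

lemma yb_sum_cong:
  assumes "pure_sum ps = pure_sum qs"
  shows "yb_sum br ps = yb_sum br qs"
proof -
  have replace: "(\<Sum>p\<leftarrow>ps. F p) = (\<Sum>p\<leftarrow>qs. F p)"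
    if "cbilinear (\<lambda>x y. F (x, y))" for F :: "'a \<times> 'a \<Rightarrow> 'a tensor4"
    using tensor_lift_pure_sum [OF that, of ps] tensor_lift_pure_sum [OF that, of qs] assms
    by simp
  have sum_swap: "(\<Sum>p\<leftarrow>us. \<Sum>q\<leftarrow>vs. G p q) = (\<Sum>q\<leftarrow>vs. \<Sum>p\<leftarrow>us. G p q)"
    for us vs :: "('a \<times> 'a) list" and G :: "_ \<Rightarrow> _ \<Rightarrow> 'a tensor4"
    by (induction us) (simp_all add: sum_list_addf)
  have "yb_sum br ps = (\<Sum>p\<leftarrow>ps. \<Sum>q\<leftarrow>ps. \<Sum>s\<leftarrow>qs. yb_term br p q s)"
    unfolding yb_sum_def by (simp add: replace yb_term_bilinear)
  also have "\<dots> = (\<Sum>p\<leftarrow>ps. \<Sum>s\<leftarrow>qs. \<Sum>q\<leftarrow>ps. yb_term br p q s)"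
    by (intro arg_cong [of _ _ sum_list] map_cong refl sum_swap)
  also have "\<dots> = (\<Sum>p\<leftarrow>ps. \<Sum>s\<leftarrow>qs. \<Sum>q\<leftarrow>qs. yb_term br p q s)"
    by (intro arg_cong [of _ _ sum_list] map_cong refl replace yb_term_bilinear)
  also have "\<dots> = (\<Sum>p\<leftarrow>ps. \<Sum>q\<leftarrow>qs. \<Sum>s\<leftarrow>qs. yb_term br p q s)"
    by (intro arg_cong [of _ _ sum_list] map_cong refl sum_swap)
  also have "\<dots> = (\<Sum>q\<leftarrow>qs. \<Sum>p\<leftarrow>ps. \<Sum>s\<leftarrow>qs. yb_term br p q s)"
    by (rule sum_swap)
  also have "\<dots> = (\<Sum>q\<leftarrow>qs. \<Sum>s\<leftarrow>qs. \<Sum>p\<leftarrow>ps. yb_term br p q s)"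
    by (intro arg_cong [of _ _ sum_list] map_cong refl sum_swap)
  also have "\<dots> = (\<Sum>q\<leftarrow>qs. \<Sum>s\<leftarrow>qs. \<Sum>p\<leftarrow>qs. yb_term br p q s)"
    by (intro arg_cong [of _ _ sum_list] map_cong refl replace yb_term_bilinear)
  also have "\<dots> = (\<Sum>q\<leftarrow>qs. \<Sum>p\<leftarrow>qs. \<Sum>s\<leftarrow>qs. yb_term br p q s)"
    by (intro arg_cong [of _ _ sum_list] map_cong refl sum_swap)
  also have "\<dots> = yb_sum br qs"
    unfolding yb_sum_def by (rule sum_swap)
  finally show ?thesis .
qed

lemma yang_baxter_eq:
  assumes "r = pure_sum ps"
  shows "yang_baxter br r = yb_sum br ps"
  unfolding yang_baxter_def
  by (rule yb_sum_cong) (use assms in \<open>metis (mono_tags, lifting) someI\<close>)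

end

end

theory Submission
  imports Defs
begin

text \<open>
  Write \<open>r = \<Sum>\<^sub>i e\<^sub>i \<otimes> v\<^sub>i\<close>; by skew-symmetry also \<open>r = - \<Sum>\<^sub>i v\<^sub>i \<otimes> e\<^sub>i\<close>. Choosing a
  suitable one of the two expressions in each slot, \<open>[[r,r,r]]\<close> becomes the alternating sum, over
  the four positions of the bracket, of the tensors built from
  \<open>[v\<^sub>i,v\<^sub>j,v\<^sub>k]\<close> and \<open>e\<^sub>i, e\<^sub>j, e\<^sub>k\<close>. In all four cases the bracket of three basis vectors is a
  multiple of the missing one. Hence the coefficient of the missing basis vector in
  \<open>[v\<^sub>i,v\<^sub>j,v\<^sub>k]\<close> is a multiple of a skew-symmetric \<open>3 \<times> 3\<close> determinant, so it vanishes, and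
  \<open>[v\<^sub>i,v\<^sub>j,v\<^sub>k]\<close> is a combination of \<open>e\<^sub>i, e\<^sub>j, e\<^sub>k\<close>. The terms of the alternating sum
  then cancel in pairs.
\<close>

lemma tensor_zero_left [simp]: "0 \<otimes> y = 0"
  using tensor_add_left[of 0 0 y] by simp

lemma tensor_zero_right [simp]: "x \<otimes> 0 = 0"
  using tensor_add_right[of x 0 0] by simp

lemma tensor_minus_left [simp]: "(- x) \<otimes> y = - (x \<otimes> y)"
  using tensor_add_left[of x "- x" y] by (simp add: eq_neg_iff_add_eq_0 add.commute)

lemma tensor_minus_right [simp]: "x \<otimes> (- y) = - (x \<otimes> y)"
  using tensor_add_right[of x y "- y"] by (simp add: eq_neg_iff_add_eq_0 add.commute)

lemma tensor_diff_left: "(x - x') \<otimes> y = x \<otimes> y - x' \<otimes> y"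
  using tensor_add_left[of x "- x'" y] by simp

lemma tensor_diff_right: "x \<otimes> (y - y') = x \<otimes> y - x \<otimes> y'"
  using tensor_add_right[of x y "- y'"] by simp

lemmas tensor_linear_simps =
  tensor_add_left tensor_add_right tensor_diff_left tensor_diff_right
  tensor_scale_left tensor_scale_right scaleC_add_right

lemma cbilinear_sum_list:
  assumes "\<And>p. cbilinear (B p)"
  shows "cbilinear (\<lambda>x y. \<Sum>p\<leftarrow>ps. B p x y)"
proof -
  have "clinear (\<lambda>x. B p x y)" "clinear (B p x)" for p x y
    using assms unfolding cbilinear_def by auto
  note lin = clinearD[OF this(1)] clinearD[OF this(2)]
  show ?thesis
    unfolding cbilinear_def
    by (auto intro!: clinearI simp: lin sum_list_addf)
      (induction ps; simp add: lin scaleC_add_right)+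
qed

text \<open>Both sums are values of \<open>tensor_lift\<close> at the same tensor.\<close>

lemma pure_sum_cong:
  assumes "cbilinear (\<lambda>x y. F (x, y))" "pure_sum ps = pure_sum qs"
  shows "(\<Sum>p\<leftarrow>ps. F p) = (\<Sum>p\<leftarrow>qs. F p)"
  using tensor_lift_pure_sum[OF assms(1), of ps] tensor_lift_pure_sum[OF assms(1), of qs] assms(2)
  by simp

text \<open>The pairs are replaced one at a time, so each may have its own representation;
  \<open>cbilinear_sum_list\<close> keeps the inner sums bilinear in the pair being
  replaced.\<close>

lemma pure_sum_cong3:
  assumes "\<And>q s. cbilinear (\<lambda>x y. G (x, y) q s)"
    and "\<And>p s. cbilinear (\<lambda>x y. G p (x, y) s)"
    and "\<And>p q. cbilinear (\<lambda>x y. G p q (x, y))"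
    and "pure_sum ps = pure_sum ps'" "pure_sum qs = pure_sum qs'" "pure_sum ss = pure_sum ss'"
  shows "(\<Sum>p\<leftarrow>ps. \<Sum>q\<leftarrow>qs. \<Sum>s\<leftarrow>ss. G p q s) = (\<Sum>p\<leftarrow>ps'. \<Sum>q\<leftarrow>qs'. \<Sum>s\<leftarrow>ss'. G p q s)"
proof -
  have "(\<Sum>p\<leftarrow>ps. \<Sum>q\<leftarrow>qs. \<Sum>s\<leftarrow>ss. G p q s) = (\<Sum>p\<leftarrow>ps'. \<Sum>q\<leftarrow>qs. \<Sum>s\<leftarrow>ss. G p q s)"
    by (intro pure_sum_cong cbilinear_sum_list assms)
  also have "\<dots> = (\<Sum>p\<leftarrow>ps'. \<Sum>q\<leftarrow>qs'. \<Sum>s\<leftarrow>ss. G p q s)"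
    by (intro arg_cong[of _ _ sum_list] map_cong refl pure_sum_cong cbilinear_sum_list assms)
  also have "\<dots> = (\<Sum>p\<leftarrow>ps'. \<Sum>q\<leftarrow>qs'. \<Sum>s\<leftarrow>ss'. G p q s)"
    by (intro arg_cong[of _ _ sum_list] map_cong refl pure_sum_cong assms)
  finally show ?thesis .
qed

lemma span4_coordinates:
  assumes "complex_vector.span {e1, e2, e3, e4} = UNIV"
  obtains a b c d where "x = a *\<^sub>C e1 + b *\<^sub>C e2 + c *\<^sub>C e3 + d *\<^sub>C e4"
proof -
  have "x \<in> complex_vector.span {e1, e2, e3, e4}" using assms by simp
  then obtain a b c d where "x - a *\<^sub>C e1 - b *\<^sub>C e2 - c *\<^sub>C e3 - d *\<^sub>C e4 = 0"
    by (auto simp: complex_vector.span_breakdown_eq)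
  then show ?thesis using that[of a b c d] by (simp add: algebra_simps)
qed

lemma wedge2_coordinates:
  assumes span: "complex_vector.span {e1, e2, e3, e4} = UNIV" and r: "r \<in> wedge2"
  obtains a12 a13 a14 a23 a24 a34 where
    "r = a12 *\<^sub>C wedge e1 e2 + a13 *\<^sub>C wedge e1 e3 + a14 *\<^sub>C wedge e1 e4 +
         a23 *\<^sub>C wedge e2 e3 + a24 *\<^sub>C wedge e2 e4 + a34 *\<^sub>C wedge e3 e4"
proof -
  let ?B = "{wedge e1 e2, wedge e1 e3, wedge e1 e4, wedge e2 e3, wedge e2 e4, wedge e3 e4}"
  have "wedge x y \<in> complex_vector.span ?B" for x y
  proof -
    obtain a b c d where x: "x = a *\<^sub>C e1 + b *\<^sub>C e2 + c *\<^sub>C e3 + d *\<^sub>C e4"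
      using span4_coordinates[OF span] .
    obtain a' b' c' d' where y: "y = a' *\<^sub>C e1 + b' *\<^sub>C e2 + c' *\<^sub>C e3 + d' *\<^sub>C e4"
      using span4_coordinates[OF span] .
    \<comment> \<open>The coefficients are the 2 x 2 minors of the two coordinate rows.\<close>
    have "wedge x y =
        (a * b' - b * a') *\<^sub>C wedge e1 e2 + (a * c' - c * a') *\<^sub>C wedge e1 e3 +
        (a * d' - d * a') *\<^sub>C wedge e1 e4 + (b * c' - c * b') *\<^sub>C wedge e2 e3 +
        (b * d' - d * b') *\<^sub>C wedge e2 e4 + (c * d' - d * c') *\<^sub>C wedge e3 e4"
      by (simp add: x y wedge_def tensor_linear_simps complex_vector.scale_left_diff_distrib
          complex_vector.scale_right_diff_distrib algebra_simps)
    then show ?thesis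
      by (simp add: complex_vector.span_add complex_vector.span_scale complex_vector.span_base)
  qed
  then have "wedge2 \<subseteq> complex_vector.span ?B"
    unfolding wedge2_def
    by (intro complex_vector.span_minimal) (auto simp: complex_vector.subspace_span)
  then have "r \<in> complex_vector.span ?B" using r by blast
  then obtain a12 a13 a14 a23 a24 a34 where
    "r - a12 *\<^sub>C wedge e1 e2 - a13 *\<^sub>C wedge e1 e3 - a14 *\<^sub>C wedge e1 e4 -
     a23 *\<^sub>C wedge e2 e3 - a24 *\<^sub>C wedge e2 e4 - a34 *\<^sub>C wedge e3 e4 = 0"
    by (auto simp: complex_vector.span_breakdown_eq)
  then show ?thesis
    using that[of a12 a13 a14 a23 a24 a34] by (simp add: algebra_simps)
qed

context three_lie_algebra
begin

lemma br_same: "br x x y = 0" "br x y y = 0" "br x y x = 0"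
proof -
  \<comment> \<open>Here 2 is an invertible scalar.\<close>
  have self_neg: "z = 0" if "z = - z" for z :: 'a
  proof -
    have "2 *\<^sub>C z = z + z" using scaleC_add_left[of 1 1 z] by (simp add: scaleC_one)
    also have "\<dots> = 0" using that by (metis add.right_inverse)
    finally show ?thesis by simp
  qed
  show *: "br x x y = 0" for x y using skew_12[of x x y] by (rule self_neg)
  show "br x y y = 0" using skew_23[of x y y] by (rule self_neg)
  show "br x y x = 0" using skew_23[of x y x] * by simp
qed

text \<open>Later uses fix \<open>x\<close>, \<open>y\<close>, \<open>z\<close> to an increasing
  triple, so that as rewrite rules these send every permuted bracket to the sorted one.\<close>

lemma br_permute:
  "br x z y = - br x y z" "br y x z = - br x y z" "br z y x = - br x y z"
  "br y z x = br x y z" "br z x y = br x y z"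
  using skew_12 skew_23 by (metis minus_minus)+

lemma br_minus: "br (- x) y z = - br x y z" "br x (- y) z = - br x y z" "br x y (- z) = - br x y z"
  using clinearD(2)[OF linear_1, of "- 1"] clinearD(2)[OF linear_2, of _ "- 1"]
    clinearD(2)[OF linear_3, of _ _ "- 1"]
  by (simp_all add: scaleC_one)

lemma br_diff:
  "br (x - x') y z = br x y z - br x' y z"
  "br x (y - y') z = br x y z - br x y' z"
  "br x y (z - z') = br x y z - br x y z'"
  using clinearD(1)[OF linear_1, of x "- x'"] clinearD(1)[OF linear_2, of _ y "- y'"]
    clinearD(1)[OF linear_3, of _ _ z "- z'"]
  by (simp_all add: br_minus)

text \<open>Each of the four summands is bilinear in each pair, so the representation can be chosen
  slot by slot: \<open>qs\<close> where the first component enters the bracket, \<open>ps\<close>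
  where the second does.\<close>

lemma yb_sum_flip:
  assumes "pure_sum ps = pure_sum qs"
  shows "yb_sum br ps =
    (\<Sum>(xi, yi)\<leftarrow>qs. \<Sum>(xj, yj)\<leftarrow>qs. \<Sum>(xk, yk)\<leftarrow>qs. br xi xj xk \<otimes> yi \<otimes> yj \<otimes> yk) +
    (\<Sum>(xi, yi)\<leftarrow>ps. \<Sum>(xj, yj)\<leftarrow>qs. \<Sum>(xk, yk)\<leftarrow>qs. xi \<otimes> br yi xj xk \<otimes> yj \<otimes> yk) +
    (\<Sum>(xi, yi)\<leftarrow>ps. \<Sum>(xj, yj)\<leftarrow>ps. \<Sum>(xk, yk)\<leftarrow>qs. xi \<otimes> xj \<otimes> br yi yj xk \<otimes> yk) +
    (\<Sum>(xi, yi)\<leftarrow>ps. \<Sum>(xj, yj)\<leftarrow>ps. \<Sum>(xk, yk)\<leftarrow>ps. xi \<otimes> xj \<otimes> xk \<otimes> br yi yj yk)"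
proof -
  define G1 :: "'a \<times> 'a \<Rightarrow> 'a \<times> 'a \<Rightarrow> 'a \<times> 'a \<Rightarrow> 'a tensor4"
    where "G1 = (\<lambda>(xi, yi) (xj, yj) (xk, yk). br xi xj xk \<otimes> yi \<otimes> yj \<otimes> yk)"
  define G2 :: "'a \<times> 'a \<Rightarrow> 'a \<times> 'a \<Rightarrow> 'a \<times> 'a \<Rightarrow> 'a tensor4"
    where "G2 = (\<lambda>(xi, yi) (xj, yj) (xk, yk). xi \<otimes> br yi xj xk \<otimes> yj \<otimes> yk)"
  define G3 :: "'a \<times> 'a \<Rightarrow> 'a \<times> 'a \<Rightarrow> 'a \<times> 'a \<Rightarrow> 'a tensor4"
    where "G3 = (\<lambda>(xi, yi) (xj, yj) (xk, yk). xi \<otimes> xj \<otimes> br yi yj xk \<otimes> yk)"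
  define G4 :: "'a \<times> 'a \<Rightarrow> 'a \<times> 'a \<Rightarrow> 'a \<times> 'a \<Rightarrow> 'a tensor4"
    where "G4 = (\<lambda>(xi, yi) (xj, yj) (xk, yk). xi \<otimes> xj \<otimes> xk \<otimes> br yi yj yk)"
  note G_defs = G1_def G2_def G3_def G4_def
  note bilinearI = cbilinear_def[THEN iffD2, OF conjI, OF allI allI, OF clinearI clinearI]
  let ?S = "\<lambda>G us vs ws. \<Sum>p\<leftarrow>us. \<Sum>q\<leftarrow>vs. \<Sum>s\<leftarrow>ws. G p q s"
  have "yb_sum br ps = ?S G1 ps ps ps + ?S G2 ps ps ps + ?S G3 ps ps ps + ?S G4 ps ps ps"
    unfolding yb_sum_def
    by (simp add: yb_term_def G_defs case_prod_unfold sum_list_addf)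
  also have "?S G1 ps ps ps = ?S G1 qs qs qs"
    by (intro pure_sum_cong3 bilinearI assms refl)
      (auto simp: G_defs multilinear_simps scaleC_add_right split: prod.split)
  also have "?S G2 ps ps ps = ?S G2 ps qs qs"
    by (intro pure_sum_cong3 bilinearI assms refl)
      (auto simp: G_defs multilinear_simps scaleC_add_right split: prod.split)
  also have "?S G3 ps ps ps = ?S G3 ps ps qs"
    by (intro pure_sum_cong3 bilinearI assms refl)
      (auto simp: G_defs multilinear_simps scaleC_add_right split: prod.split)
  finally show ?thesis by (simp add: G_defs case_prod_unfold)
qed

text \<open>After the flip only the \<open>v\<close>'s occur inside brackets, and the minus signs
  make the sum alternate with the bracket position. A tensor with one \<open>e\<close> repeated at
  positions p < q arises with the bracket at p or at q; the two orders of the indices outside the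
  bracket differ by a cycle of sign (-1)^(q-p-1), the positions by (-1)^(q-p), so the two terms
  cancel.\<close>

lemma yb_sum_eq_0:
  assumes rep: "pure_sum [(e1, v1), (e2, v2), (e3, v3), (e4, v4)] =
      pure_sum [(- v1, e1), (- v2, e2), (- v3, e3), (- v4, e4)]"
    and br: "br v1 v2 v3 = a1 *\<^sub>C e1 + a2 *\<^sub>C e2 + a3 *\<^sub>C e3"
      "br v1 v2 v4 = b1 *\<^sub>C e1 + b2 *\<^sub>C e2 + b4 *\<^sub>C e4"
      "br v1 v3 v4 = c1 *\<^sub>C e1 + c3 *\<^sub>C e3 + c4 *\<^sub>C e4"
      "br v2 v3 v4 = d2 *\<^sub>C e2 + d3 *\<^sub>C e3 + d4 *\<^sub>C e4"
  shows "yb_sum br [(e1, v1), (e2, v2), (e3, v3), (e4, v4)] = 0"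
  unfolding yb_sum_flip[OF rep]
  by (simp add: br_minus br_same
      br_permute[where x = v1 and y = v2 and z = v3]
      br_permute[where x = v1 and y = v2 and z = v4]
      br_permute[where x = v1 and y = v3 and z = v4]
      br_permute[where x = v2 and y = v3 and z = v4]
      br tensor_linear_simps)

text \<open>The free scalars \<open>d1\<close>, ..., \<open>d4\<close> treat all four multiplication
  tables at once.\<close>

lemma yang_baxter_wedge2_eq_0:
  assumes span: "complex_vector.span {e1, e2, e3, e4} = UNIV"
    and br: "br e1 e2 e3 = d4 *\<^sub>C e4" "br e1 e2 e4 = d3 *\<^sub>C e3"
      "br e1 e3 e4 = d2 *\<^sub>C e2" "br e2 e3 e4 = d1 *\<^sub>C e1"
    and r: "r \<in> wedge2"
  shows "yang_baxter br r = 0"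
proof -
  obtain a12 a13 a14 a23 a24 a34 where r_eq:
    "r = a12 *\<^sub>C wedge e1 e2 + a13 *\<^sub>C wedge e1 e3 + a14 *\<^sub>C wedge e1 e4 +
         a23 *\<^sub>C wedge e2 e3 + a24 *\<^sub>C wedge e2 e4 + a34 *\<^sub>C wedge e3 e4"
    using wedge2_coordinates[OF span r] .
  \<comment> \<open>The \<open>v\<close>'s are the rows of the skew-symmetric coefficient matrix of
    \<open>r\<close>; its columns are their negatives, which gives the second representation
    \<open>qs\<close>.\<close>
  define v1 where "v1 = a12 *\<^sub>C e2 + a13 *\<^sub>C e3 + a14 *\<^sub>C e4"
  define v2 where "v2 = (- a12) *\<^sub>C e1 + a23 *\<^sub>C e3 + a24 *\<^sub>C e4"
  define v3 where "v3 = (- a13) *\<^sub>C e1 + (- a23) *\<^sub>C e2 + a34 *\<^sub>C e4"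
  define v4 where "v4 = (- a14) *\<^sub>C e1 + (- a24) *\<^sub>C e2 + (- a34) *\<^sub>C e3"
  note v_defs = v1_def v2_def v3_def v4_def
  have ps: "r = pure_sum [(e1, v1), (e2, v2), (e3, v3), (e4, v4)]"
    and qs: "r = pure_sum [(- v1, e1), (- v2, e2), (- v3, e3), (- v4, e4)]"
    by (simp_all add: r_eq pure_sum_def v_defs wedge_def tensor_linear_simps algebra_simps
        complex_vector.scale_right_diff_distrib)
  \<comment> \<open>the Pfaffian of the coefficient matrix, a common factor of its \<open>3 \<times> 3\<close> minors\<close>
  define P where "P = a12 * a34 - a13 * a24 + a14 * a23"
  note br_simps = multilinear_simps(1-6) br_diff br_minus br_same
      br_permute[where x = e1 and y = e2 and z = e3]
      br_permute[where x = e1 and y = e2 and z = e4]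
      br_permute[where x = e1 and y = e3 and z = e4]
      br_permute[where x = e2 and y = e3 and z = e4]
      br
  note expand = v_defs P_def br_simps algebra_simps
    complex_vector.scale_right_diff_distrib complex_vector.scale_left_diff_distrib
    scaleC_add_left scaleC_add_right
  \<comment> \<open>Omitting row k and column l (k and l distinct) leaves a minor equal, up to sign,
    to \<open>P\<close> times the entry at the other two indices; for k = l the minor is
    zero.\<close>
  have "br v1 v2 v3 = (d1 * a23 * P) *\<^sub>C e1 + (d2 * a13 * P) *\<^sub>C e2 + (d3 * a12 * P) *\<^sub>C e3"
    by (simp add: expand)
  moreover have "br v1 v2 v4 = (d1 * a24 * P) *\<^sub>C e1 + (d2 * a14 * P) *\<^sub>C e2 + (- d4 * a12 * P) *\<^sub>C e4"
    by (simp add: expand)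
  moreover have "br v1 v3 v4 = (d1 * a34 * P) *\<^sub>C e1 + (- d3 * a14 * P) *\<^sub>C e3 + (- d4 * a13 * P) *\<^sub>C e4"
    by (simp add: expand)
  moreover have "br v2 v3 v4 = (- d2 * a34 * P) *\<^sub>C e2 + (- d3 * a24 * P) *\<^sub>C e3 + (- d4 * a23 * P) *\<^sub>C e4"
    by (simp add: expand)
  ultimately have "yb_sum br [(e1, v1), (e2, v2), (e3, v3), (e4, v4)] = 0"
    by (rule yb_sum_eq_0[OF trans[OF ps[symmetric] qs]])
  then show ?thesis using yang_baxter_eq[OF ps] by simp
qed

end

theorem theorem3p7:
  fixes br :: "'a::complex_vector \<Rightarrow> 'a \<Rightarrow> 'a \<Rightarrow> 'a"
    and e1 e2 e3 e4 :: 'a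
    and r :: "('a, 'a) tensor"
  assumes "three_lie_algebra br"
    and "distinct [e1, e2, e3, e4]"
    and "complex_vector.independent {e1, e2, e3, e4}"
    and "complex_vector.span {e1, e2, e3, e4} = UNIV"
    and "(br e1 e2 e3 = e4 \<and> br e1 e2 e4 = e3 \<and> br e1 e3 e4 = e2 \<and> br e2 e3 e4 = e1) \<or>
         (br e1 e2 e3 = 0 \<and> br e1 e2 e4 = 0 \<and> br e1 e3 e4 = 0 \<and> br e2 e3 e4 = e1) \<or>
         (br e1 e2 e3 = 0 \<and> br e1 e2 e4 = 0 \<and> br e1 e3 e4 = e2 \<and> br e2 e3 e4 = e1) \<or>
         (br e1 e2 e3 = 0 \<and> br e1 e2 e4 = e3 \<and> br e1 e3 e4 = e2 \<and> br e2 e3 e4 = e1)"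
    and "r \<in> wedge2"
  shows "yang_baxter br r = 0"
proof -
  interpret three_lie_algebra br by fact
  \<comment> \<open>The scalar 1 serves for a listed bracket and 0 for a vanishing one.\<close>
  obtain d1 d2 d3 d4 where "br e1 e2 e3 = d4 *\<^sub>C e4" "br e1 e2 e4 = d3 *\<^sub>C e3"
      "br e1 e3 e4 = d2 *\<^sub>C e2" "br e2 e3 e4 = d1 *\<^sub>C e1"
    using assms(5) by (metis scaleC_one complex_vector.scale_zero_left)
  then show ?thesis using yang_baxter_wedge2_eq_0 assms(4,6) by blast
qed

end
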